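(* Consider the algorithm dist-EF-SGD (described in the context) with $M\ge1$ workers, a $\delta$-compressor $\mathcal C$ with $\delta\in(0,1)$, and learning rates $\{\eta_t\}$ with $\eta_{-1}=0$. Suppose Assumptions 2 and 3 in the context hold, and let $G^2=\sigma^2+\omega^2$. If $\{\eta_t\}$ is a non-decreasing sequence such that $\eta_t>0$ for all $t\ge0$, then for every $t\ge0$, $$\mathbf E\left[\left\lVert\tilde e_{t+1}+\frac1M\sum_{i=1}^M e_{t+1,i}\right\rVert^2\right]\le\frac{8(1-\delta)G^2}{\delta^2}\left(1+\frac{16}{\delta^2}\right).$$
   Context: $\lVert\cdot\rVert$ is the Euclidean norm on $\mathbb R^d$. Compressor: a (possibly randomized) operator $\mathcal C:\mathbb R^d\to\mathbb R^d$ is a $\delta$-compressor, $\delta\in(0,1)$, if $\mathbf E_{\mathcal C}\lVert\mathcal C(x)-x\rVert^2\le(1-\delta)\lVert x\rVert^2$ for all $x\in\mathbb R^d$, the expectation being over the randomness of $\mathcal C$ (in the algorithm, this bound holds conditionally on the input of each application of $\mathcal C$). Loss: given a loss function $\mathcal L(x,\xi)$, $f(x)=\mathbf E_\xi[\mathcal L(x,\xi)]$ is assumed differentiable, where $x\in\mathbb R^d$ and $\xi$ is a data batch drawn from some unknown distribution. Algorithm dist-EF-SGD. Inputs: $\mathcal L$, learning rates $\{\eta_t\}$ with $\eta_{-1}=0$, number of workers $M$, compressor $\mathcal C$. Initialize $x_0\in\mathbb R^d$, $e_{0,i}=0\in\mathbb R^d$ for each worker $i=1,\dots,M$, and $\tilde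 e_0=0\in\mathbb R^d$ on the server. For $t=0,1,2,\dots$: each worker $i$ picks data $\xi_{t,i}$ and computes $g_{t,i}=\nabla\mathcal L(x_t,\xi_{t,i})$ (gradient in $x$), $p_{t,i}=g_{t,i}+\frac{\eta_{t-1}}{\eta_t}e_{t,i}$, $\Delta_{t,i}=\mathcal C(p_{t,i})$, $e_{t+1,i}=p_{t,i}-\Delta_{t,i}$; the server computes $\tilde p_t=\frac1M\sum_{i=1}^M\Delta_{t,i}+\frac{\eta_{t-1}}{\eta_t}\tilde e_t$, $\tilde\Delta_t=\mathcal C(\tilde p_t)$, $\tilde e_{t+1}=\tilde p_t-\tilde\Delta_t$; and all workers update $x_{t+1}=x_t-\eta_t\tilde\Delta_t$. $\mathbf E_t$ denotes expectation at iteration $t$, i.e. conditional on everything that happened before iteration $t$; $\mathbf E$ is total expectation. Assumption 2: $\mathbf E_t[g_{t,i}]=\nabla f(x_t)$ and $\mathbf E_t[\lVert g_{t,i}-\nabla f(x_t)\rVert^2]\le\sigma^2$ for all $t,i$. Assumption 3: $\lVert\nabla f(x_t)\rVert^2\le\omega^2$ for all $t$. *)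

theory Defs
  imports "HOL-Probability.Probability"
begin

definition gradient :: "('a::real_inner \<Rightarrow> real) \<Rightarrow> 'a \<Rightarrow> 'a" where
  "gradient h y = (THE v. GDERIV h y :> v)"

definition expected_loss :: "'z measure \<Rightarrow> ('a \<Rightarrow> 'z \<Rightarrow> real) \<Rightarrow> 'a \<Rightarrow> real" where
  "expected_loss D L y = (\<integral>z. L y z \<partial>D)"

text \<open>
  A randomized operator is a map \<open>C y s\<close> of the input \<open>y\<close> and a random seed \<open>s\<close> with law \<open>S\<close>.
  The expectation is a nonnegative Lebesgue integral, so the bound forces it to be finite.
\<close>

definition delta_compressor ::
  "'s measure \<Rightarrow> (real^'d \<Rightarrow> 's \<Rightarrow> real^'d) \<Rightarrow> real \<Rightarrow> bool" where
  "delta_compressor S C \<delta> \<longleftrightarrow>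
     0 < \<delta> \<and> \<delta> < 1 \<and> prob_space S \<and>
     (\<lambda>(y, s). C y s) \<in> borel_measurable (borel \<Otimes>\<^sub>M S) \<and>
     (\<forall>y. (\<integral>\<^sup>+s. ennreal ((norm (C y s - y))\<^sup>2) \<partial>S) \<le> ennreal ((1 - \<delta>) * (norm y)\<^sup>2))"

text \<open>
  The compression bound for one application of the compressor inside the algorithm, with random
  input \<open>P\<close> and output \<open>Q\<close>, conditionally on the sigma-algebra generated by the input.
\<close>

definition compresses_given_input ::
  "'w measure \<Rightarrow> real \<Rightarrow> ('w \<Rightarrow> real^'d) \<Rightarrow> ('w \<Rightarrow> real^'d) \<Rightarrow> bool" where
  "compresses_given_input \<Omega> \<delta> P Q \<longleftrightarrow>
     (AE w in \<Omega>. nn_cond_exp \<Omega> (vimage_algebra (space \<Omega>) P borel)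
                    (\<lambda>w. ennreal ((norm (Q w - P w))\<^sup>2)) w
                 \<le> ennreal ((1 - \<delta>) * (norm (P w))\<^sup>2))"

text \<open>
  The library provides conditional expectations of real functions only; for vectors they are taken
  componentwise.
\<close>

definition vec_cond_exp ::
  "'w measure \<Rightarrow> 'w measure \<Rightarrow> ('w \<Rightarrow> real^'d) \<Rightarrow> 'w \<Rightarrow> real^'d" where
  "vec_cond_exp \<Omega> F X w = (\<chi> k. real_cond_exp \<Omega> F (\<lambda>w. X w $ k) w)"

text \<open>The learning rate of the preceding iteration, with the convention \<open>\<eta>\<^sub>-\<^sub>1 = 0\<close>.\<close>

definition prev_rate :: "(nat \<Rightarrow> real) \<Rightarrow> nat \<Rightarrow> real" where
  "prev_rate \<eta> t = (case t of 0 \<Rightarrow> 0 | Suc s \<Rightarrow> \<eta> s)"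

text \<open>
  The run of dist-EF-SGD on the outcomes \<open>w\<close> of a probability space \<open>\<Omega>\<close>. Workers are
  indexed by \<open>{1..M}\<close>. The sources of randomness are the data \<open>\<xi> t i\<close>, the compressor seeds
  \<open>r t i\<close> of the workers and the compressor seeds \<open>rs t\<close> of the server. The processes \<open>es\<close>,
  \<open>ps\<close> and \<open>\<Delta>s\<close> are the ones on the server (those written with a tilde).
\<close>

definition dist_EF_SGD ::
  "'w measure \<Rightarrow> (real^'d \<Rightarrow> 'z \<Rightarrow> real) \<Rightarrow> (real^'d \<Rightarrow> 's \<Rightarrow> real^'d) \<Rightarrow> (nat \<Rightarrow> real) \<Rightarrow> nat \<Rightarrow> real^'d \<Rightarrow>
   (nat \<Rightarrow> nat \<Rightarrow> 'w \<Rightarrow> 'z) \<Rightarrow> (nat \<Rightarrow> nat \<Rightarrow> 'w \<Rightarrow> 's) \<Rightarrow> (nat \<Rightarrow> 'w \<Rightarrow> 's) \<Rightarrow>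
   (nat \<Rightarrow> 'w \<Rightarrow> real^'d) \<Rightarrow>
   (nat \<Rightarrow> nat \<Rightarrow> 'w \<Rightarrow> real^'d) \<Rightarrow> (nat \<Rightarrow> nat \<Rightarrow> 'w \<Rightarrow> real^'d) \<Rightarrow>
   (nat \<Rightarrow> nat \<Rightarrow> 'w \<Rightarrow> real^'d) \<Rightarrow> (nat \<Rightarrow> nat \<Rightarrow> 'w \<Rightarrow> real^'d) \<Rightarrow>
   (nat \<Rightarrow> 'w \<Rightarrow> real^'d) \<Rightarrow> (nat \<Rightarrow> 'w \<Rightarrow> real^'d) \<Rightarrow> (nat \<Rightarrow> 'w \<Rightarrow> real^'d) \<Rightarrow> bool" where
  "dist_EF_SGD \<Omega> L C \<eta> M x0 \<xi> r rs x g p \<Delta> e ps \<Delta>s es \<longleftrightarrow>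
     (\<forall>w\<in>space \<Omega>.
        x 0 w = x0 \<and> (\<forall>i\<in>{1..M}. e 0 i w = 0) \<and> es 0 w = 0 \<and>
        (\<forall>t.
           (\<forall>i\<in>{1..M}.
              g t i w = gradient (\<lambda>y. L y (\<xi> t i w)) (x t w) \<and>
              p t i w = g t i w + (prev_rate \<eta> t / \<eta> t) *\<^sub>R e t i w \<and>
              \<Delta> t i w = C (p t i w) (r t i w) \<and>
              e (Suc t) i w = p t i w - \<Delta> t i w) \<and>
           ps t w = (1 / real M) *\<^sub>R (\<Sum>i=1..M. \<Delta> t i w) + (prev_rate \<eta> t / \<eta> t) *\<^sub>R es t w \<and>
           \<Delta>s t w = C (ps t w) (rs t w) \<and>
           es (Suc t) w = ps t w - \<Delta>s t w \<and>
           x (Suc t) w = x t w - \<eta> t *\<^sub>R \<Delta>s t w))"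

text \<open>
  Everything that happened before iteration \<open>t\<close>: the sigma-algebra on the outcomes generated by
  all data and all compressor seeds of the iterations \<open>s < t\<close>.
\<close>

definition history ::
  "'w measure \<Rightarrow> 'z measure \<Rightarrow> 's measure \<Rightarrow> nat \<Rightarrow>
   (nat \<Rightarrow> nat \<Rightarrow> 'w \<Rightarrow> 'z) \<Rightarrow> (nat \<Rightarrow> nat \<Rightarrow> 'w \<Rightarrow> 's) \<Rightarrow> (nat \<Rightarrow> 'w \<Rightarrow> 's) \<Rightarrow> nat \<Rightarrow> 'w measure" where
  "history \<Omega> D S M \<xi> r rs t = sigma (space \<Omega>)
     (\<Union>s\<in>{..<t}.
        (\<Union>i\<in>{1..M}. sets (vimage_algebra (space \<Omega>) (\<xi> s i) D) \<union>
                     sets (vimage_algebra (space \<Omega>) (r s i) S)) \<union>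
        sets (vimage_algebra (space \<Omega>) (rs s) S))"

definition unbiased_bounded_variance ::
  "'w measure \<Rightarrow> (nat \<Rightarrow> 'w measure) \<Rightarrow> nat \<Rightarrow> (real^'d \<Rightarrow> real) \<Rightarrow>
   (nat \<Rightarrow> 'w \<Rightarrow> real^'d) \<Rightarrow> (nat \<Rightarrow> nat \<Rightarrow> 'w \<Rightarrow> real^'d) \<Rightarrow> real \<Rightarrow> bool" where
  "unbiased_bounded_variance \<Omega> F M f x g \<sigma> \<longleftrightarrow>
     (\<forall>t. \<forall>i\<in>{1..M}.
        integrable \<Omega> (g t i) \<and>
        (AE w in \<Omega>. vec_cond_exp \<Omega> (F t) (g t i) w = gradient f (x t w)) \<and>
        (AE w in \<Omega>. nn_cond_exp \<Omega> (F t)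
                       (\<lambda>w. ennreal ((norm (g t i w - gradient f (x t w)))\<^sup>2)) w
                    \<le> ennreal (\<sigma>\<^sup>2)))"

definition bounded_gradient ::
  "'w measure \<Rightarrow> (real^'d \<Rightarrow> real) \<Rightarrow> (nat \<Rightarrow> 'w \<Rightarrow> real^'d) \<Rightarrow> real \<Rightarrow> bool" where
  "bounded_gradient \<Omega> f x \<omega> \<longleftrightarrow>
     (\<forall>t. AE w in \<Omega>. (norm (gradient f (x t w)))\<^sup>2 \<le> \<omega>\<^sup>2)"

end

theory Submission
  imports Defs
begin

text \<open>
  The compression step of every worker, and that of the server, runs the same error feedback loop:
  a fresh vector \<open>h\<close> is added to the rescaled residual of the previous round, the sum
  \<open>P = h + \<rho> v\<close> is compressed to \<open>Q\<close>, and \<open>v' = P - Q\<close> is the next residual. As the rates do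
  not decrease, \<open>0 \<le> \<rho> \<le> 1\<close>, and since the mean square of a compression error is at most the
  fraction \<open>1 - \<delta>\<close> of that of the input, residuals are contracted from round to round: if \<open>\<bbbE>\<parallel>h\<parallel>\<^sup>2 \<le> H\<close> in every round, then
  \<open>\<bbbE>\<parallel>P\<parallel>\<^sup>2 \<le> 4 H / \<delta>\<^sup>2\<close> and \<open>\<bbbE>\<parallel>v\<parallel>\<^sup>2 \<le> 4 (1 - \<delta>) H / \<delta>\<^sup>2\<close> forever (\<open>error_feedback_bounds\<close>).

  This is used twice. For a worker the fresh vector is its stochastic gradient, and \<open>H = G\<^sup>2\<close> because
  the mean square of an unbiased estimate is its variance plus the square of its mean
  (\<open>mean_square_le_variance_plus_bias\<close>). For the server the fresh vector is the average of the
  transmitted \<open>\<Delta>\<close>. Each \<open>\<Delta>\<close> is a worker's input minus its next residual, so its mean square is at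
  most \<open>2 (4 G\<^sup>2 / \<delta>\<^sup>2) + 2 (4 (1 - \<delta>) G\<^sup>2 / \<delta>\<^sup>2) \<le> 16 G\<^sup>2 / \<delta>\<^sup>2\<close>, and averaging does not increase this bound.
  The server residual therefore has mean square at most \<open>64 (1 - \<delta>) G\<^sup>2 / \<delta>\<^sup>4\<close>, the averaged worker
  residual at most \<open>4 (1 - \<delta>) G\<^sup>2 / \<delta>\<^sup>2\<close>, and twice the sum of these two numbers is the claimed bound.
\<close>

section \<open>Mean squares of random vectors\<close>

text \<open>
  Taking values in the extended nonnegative reals, a finite bound on this quantity for a
  measurable \<open>X\<close> also gives square integrability, which is thus propagated through the recursion together with the bound.
\<close>

definition mean_square :: "'w measure \<Rightarrow> ('w \<Rightarrow> 'a::real_normed_vector) \<Rightarrow> ennreal" where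
  "mean_square \<Omega> X = (\<integral>\<^sup>+w. ennreal ((norm (X w))\<^sup>2) \<partial>\<Omega>)"

lemma mean_square_cong:
  assumes "\<And>w. w \<in> space \<Omega> \<Longrightarrow> X w = Y w"
  shows "mean_square \<Omega> X = mean_square \<Omega> Y"
  unfolding mean_square_def by (rule nn_integral_cong) (simp add: assms)

text \<open>
  Young's inequality; it is the nonnegativity of \<open>c \<parallel>a / c - b\<parallel>\<^sup>2\<close> in disguise.
\<close>

lemma norm_add_squared_le:
  fixes a b :: "'a::real_inner"
  assumes "c > 0"
  shows "(norm (a + b))\<^sup>2 \<le> (1 + 1 / c) * (norm a)\<^sup>2 + (1 + c) * (norm b)\<^sup>2"
proof -
  have "0 \<le> (norm ((1 / c) *\<^sub>R a - b))\<^sup>2 * c"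
    using assms by simp
  also have "(norm ((1 / c) *\<^sub>R a - b))\<^sup>2 * c = (norm a)\<^sup>2 / c - 2 * (a \<bullet> b) + c * (norm b)\<^sup>2"
  proof -
    have "(norm ((1 / c) *\<^sub>R a - b))\<^sup>2 = (1 / c) * (1 / c) * (a \<bullet> a) - 2 * (1 / c) * (a \<bullet> b) + b \<bullet> b"
      by (simp add: power2_norm_eq_inner inner_diff_left inner_diff_right inner_commute)
    then show ?thesis
      using assms by (simp add: power2_norm_eq_inner divide_simps) (simp add: algebra_simps)
  qed
  finally show ?thesis
    by (simp add: power2_norm_eq_inner inner_add_left inner_add_right inner_commute algebra_simps)
qed

lemma mean_square_add_le:
  fixes X Y :: "'w \<Rightarrow> 'a::euclidean_space"
  assumes [measurable]: "X \<in> borel_measurable \<Omega>" "Y \<in> borel_measurable \<Omega>"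
    and "mean_square \<Omega> X \<le> ennreal A" "mean_square \<Omega> Y \<le> ennreal B"
    and "0 \<le> A" "0 \<le> B" "c > 0"
  shows "mean_square \<Omega> (\<lambda>w. X w + Y w) \<le> ennreal ((1 + 1 / c) * A + (1 + c) * B)"
proof -
  have "mean_square \<Omega> (\<lambda>w. X w + Y w)
      \<le> (\<integral>\<^sup>+w. ennreal (1 + 1 / c) * ennreal ((norm (X w))\<^sup>2) + ennreal (1 + c) * ennreal ((norm (Y w))\<^sup>2) \<partial>\<Omega>)"
    unfolding mean_square_def
  proof (rule nn_integral_mono)
    fix w
    show "ennreal ((norm (X w + Y w))\<^sup>2)
        \<le> ennreal (1 + 1 / c) * ennreal ((norm (X w))\<^sup>2) + ennreal (1 + c) * ennreal ((norm (Y w))\<^sup>2)"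
      using norm_add_squared_le[OF \<open>c > 0\<close>, of "X w" "Y w"] \<open>c > 0\<close>
      by (simp add: ennreal_mult[symmetric] ennreal_plus[symmetric] del: ennreal_plus)
  qed
  also have "\<dots> = ennreal (1 + 1 / c) * mean_square \<Omega> X + ennreal (1 + c) * mean_square \<Omega> Y"
    unfolding mean_square_def by (simp add: nn_integral_add nn_integral_cmult)
  also have "\<dots> \<le> ennreal (1 + 1 / c) * ennreal A + ennreal (1 + c) * ennreal B"
    using assms by (intro add_mono mult_left_mono) auto
  also have "\<dots> = ennreal ((1 + 1 / c) * A + (1 + c) * B)"
    using assms by (simp add: ennreal_mult[symmetric] ennreal_plus[symmetric] del: ennreal_plus)
  finally show ?thesis .
qed

lemma mean_square_scaleR_le:
  assumes "\<bar>c\<bar> \<le> 1"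
  shows "mean_square \<Omega> (\<lambda>w. c *\<^sub>R X w) \<le> mean_square \<Omega> X"
  unfolding mean_square_def
proof (intro nn_integral_mono ennreal_leI power_mono)
  show "norm (c *\<^sub>R X w) \<le> norm (X w)" for w
    using assms mult_right_mono[of "\<bar>c\<bar>" 1 "norm (X w)"] by simp
qed simp

lemma mean_square_average_le:
  fixes X :: "'i \<Rightarrow> 'w \<Rightarrow> 'a::euclidean_space"
  assumes "finite I" "I \<noteq> {}"
    and meas: "\<And>i. i \<in> I \<Longrightarrow> X i \<in> borel_measurable \<Omega>"
    and bound: "\<And>i. i \<in> I \<Longrightarrow> mean_square \<Omega> (X i) \<le> ennreal B"
    and "0 \<le> B"
  shows "mean_square \<Omega> (\<lambda>w. (1 / real (card I)) *\<^sub>R (\<Sum>i\<in>I. X i w)) \<le> ennreal B"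
proof -
  let ?n = "real (card I)"
  have n: "?n > 0"
    using assms(1,2) by (simp add: card_gt_0_iff)
  have pointwise: "(norm ((1 / ?n) *\<^sub>R (\<Sum>i\<in>I. X i w)))\<^sup>2 \<le> 1 / ?n * (\<Sum>i\<in>I. (norm (X i w))\<^sup>2)" for w
  proof -
    have "(norm (\<Sum>i\<in>I. X i w))\<^sup>2 \<le> (\<Sum>i\<in>I. norm (X i w))\<^sup>2"
      by (intro power_mono norm_sum) simp
    also have "\<dots> \<le> ?n * (\<Sum>i\<in>I. (norm (X i w))\<^sup>2)"
      using sum_squared_le_sum_of_squares[of "\<lambda>i. norm (X i w)" I] by (simp add: mult.commute)
    finally show ?thesis
      using n by (simp add: power_divide divide_simps power2_eq_square mult.commute)
  qed
  have "mean_square \<Omega> (\<lambda>w. (1 / ?n) *\<^sub>R (\<Sum>i\<in>I. X i w))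
      \<le> (\<integral>\<^sup>+w. ennreal (1 / ?n) * (\<Sum>i\<in>I. ennreal ((norm (X i w))\<^sup>2)) \<partial>\<Omega>)"
    unfolding mean_square_def
  proof (rule nn_integral_mono)
    fix w
    show "ennreal ((norm ((1 / ?n) *\<^sub>R (\<Sum>i\<in>I. X i w)))\<^sup>2)
        \<le> ennreal (1 / ?n) * (\<Sum>i\<in>I. ennreal ((norm (X i w))\<^sup>2))"
      using pointwise[of w] by (simp only: sum_ennreal zero_le_power2 norm_ge_zero ennreal_leI
          ennreal_mult[symmetric] sum_nonneg of_nat_0_le_iff zero_le_divide_1_iff)
  qed
  also have "\<dots> = ennreal (1 / ?n) * (\<Sum>i\<in>I. mean_square \<Omega> (X i))"
    using meas unfolding mean_square_def
    by (subst nn_integral_cmult) (simp_all add: nn_integral_sum borel_measurable_sum del: sum_ennreal)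
  also have "\<dots> \<le> ennreal (1 / ?n) * (\<Sum>i\<in>I. ennreal B)"
    using bound by (intro mult_left_mono sum_mono) auto
  also have "\<dots> = ennreal B"
    using n \<open>0 \<le> B\<close> by (simp add: sum_ennreal ennreal_mult[symmetric] ennreal_of_nat_eq_real_of_nat)
  finally show ?thesis .
qed

section \<open>Compression errors and error feedback\<close>

lemma (in prob_space) sigma_finite_subalgebraI:
  assumes "subalgebra M F"
  shows "sigma_finite_subalgebra M F"
  by (rule finite_measure_subalgebra_is_sigma_finite)
     (simp add: finite_measure_subalgebra_def finite_measure_subalgebra_axioms_def assms finite_measure_axioms)

lemma (in prob_space) nn_integral_nn_cond_exp:
  assumes "subalgebra M F" "h \<in> borel_measurable M"
  shows "(\<integral>\<^sup>+w. nn_cond_exp M F h w \<partial>M) = (\<integral>\<^sup>+w. h w \<partial>M)"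
  using sigma_finite_subalgebra.nn_cond_exp_intg[OF sigma_finite_subalgebraI[OF assms(1)], of "\<lambda>_. 1" h] assms(2)
  by simp

text \<open>
  Conditioning on the input leaves the total expectation of the error unchanged, so the
  conditional compression bound can be integrated.
\<close>

lemma (in prob_space) mean_square_compression_error_le:
  fixes P Q :: "'a \<Rightarrow> real^'d"
  assumes compr: "compresses_given_input M \<delta> P Q" and "\<delta> \<le> 1"
    and [measurable]: "P \<in> borel_measurable M" "Q \<in> borel_measurable M"
    and P: "mean_square M P \<le> ennreal A"
  shows "mean_square M (\<lambda>w. P w - Q w) \<le> ennreal ((1 - \<delta>) * A)"
proof -
  let ?F = "vimage_algebra (space M) P borel"
  have sub: "subalgebra M ?F"
    using measurable_sets[OF \<open>P \<in> borel_measurable M\<close>]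
    by (auto simp: subalgebra_def sets_vimage_algebra2)
  have "mean_square M (\<lambda>w. P w - Q w) = (\<integral>\<^sup>+w. ennreal ((norm (Q w - P w))\<^sup>2) \<partial>M)"
    unfolding mean_square_def by (simp add: norm_minus_commute)
  also have "\<dots> = (\<integral>\<^sup>+w. nn_cond_exp M ?F (\<lambda>w. ennreal ((norm (Q w - P w))\<^sup>2)) w \<partial>M)"
    by (rule nn_integral_nn_cond_exp[OF sub, symmetric]) measurable
  also have "\<dots> \<le> (\<integral>\<^sup>+w. ennreal (1 - \<delta>) * ennreal ((norm (P w))\<^sup>2) \<partial>M)"
    using compr \<open>\<delta> \<le> 1\<close> unfolding compresses_given_input_def
    by (intro nn_integral_mono_AE) (simp add: ennreal_mult)
  also have "\<dots> = ennreal (1 - \<delta>) * mean_square M P"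
    unfolding mean_square_def by (simp add: nn_integral_cmult)
  also have "\<dots> \<le> ennreal (1 - \<delta>) * ennreal A"
    using P by (rule mult_left_mono) simp
  also have "\<dots> = ennreal ((1 - \<delta>) * A)"
    using \<open>\<delta> \<le> 1\<close> by (simp add: ennreal_mult')
  finally show ?thesis .
qed

text \<open>
  With weight \<open>c = \<delta> / (2 (1 - \<delta>))\<close> Young's inequality turns the bound \<open>4 (1 - \<delta>) H / \<delta>\<^sup>2\<close> on the
  residual into \<open>(4 - \<delta>\<^sup>2) H / \<delta>\<^sup>2\<close> for the next input, and compressing that input restores the bound
  on the residual. So both bounds are invariants of the loop, which starts at residual zero.
\<close>

lemma (in prob_space) error_feedback_bounds:
  fixes h v P Q :: "nat \<Rightarrow> 'a \<Rightarrow> real^'d"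
  assumes \<delta>: "0 < \<delta>" "\<delta> < 1" and "0 \<le> H"
    and meas: "\<And>t. h t \<in> borel_measurable M" "\<And>t. v t \<in> borel_measurable M"
      "\<And>t. P t \<in> borel_measurable M" "\<And>t. Q t \<in> borel_measurable M"
    and fresh: "\<And>t. mean_square M (h t) \<le> ennreal H"
    and rate: "\<And>t. \<bar>\<rho> t\<bar> \<le> 1"
    and init: "\<And>w. w \<in> space M \<Longrightarrow> v 0 w = 0"
    and input: "\<And>t w. w \<in> space M \<Longrightarrow> P t w = h t w + \<rho> t *\<^sub>R v t w"
    and feedback: "\<And>t w. w \<in> space M \<Longrightarrow> v (Suc t) w = P t w - Q t w"
    and compr: "\<And>t. compresses_given_input M \<delta> (P t) (Q t)"
  shows "mean_square M (P t) \<le> ennreal (4 * H / \<delta>\<^sup>2)"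
    and "mean_square M (v (Suc t)) \<le> ennreal (4 * (1 - \<delta>) * H / \<delta>\<^sup>2)"
proof -
  let ?V = "4 * (1 - \<delta>) * H / \<delta>\<^sup>2"
  have "0 \<le> ?V"
    using \<delta> \<open>0 \<le> H\<close> by simp
  note [measurable] = meas
  have P: "mean_square M (P t) \<le> ennreal (4 * H / \<delta>\<^sup>2)" if v: "mean_square M (v t) \<le> ennreal ?V" for t
  proof -
    \<comment> \<open>With this weight, Young and compression together contract the residual by
      \<open>(1 + c) (1 - \<delta>) = 1 - \<delta> / 2\<close>, which leaves half of the gain \<open>\<delta>\<close> to absorb \<open>h\<close>.\<close>
    define c where "c = \<delta> / (2 * (1 - \<delta>))"
    have "c > 0"
      using \<delta> by (simp add: c_def)
    have c: "1 + 1 / c = (2 - \<delta>) / \<delta>" "(1 + c) * (1 - \<delta>) = (2 - \<delta>) / 2"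
      using \<delta> by (simp_all add: c_def field_simps)
    have "mean_square M (P t) = mean_square M (\<lambda>w. h t w + \<rho> t *\<^sub>R v t w)"
      by (rule mean_square_cong) (rule input)
    also have "\<dots> \<le> ennreal ((1 + 1 / c) * H + (1 + c) * ?V)"
    proof (rule mean_square_add_le[OF _ _ fresh])
      show "mean_square M (\<lambda>w. \<rho> t *\<^sub>R v t w) \<le> ennreal ?V"
        using mean_square_scaleR_le[OF rate] v by (rule order_trans)
    qed (use \<open>0 \<le> ?V\<close> \<open>0 \<le> H\<close> \<open>c > 0\<close> in auto)
    also have "(1 + 1 / c) * H + (1 + c) * ?V = (1 + 1 / c) * H + ((1 + c) * (1 - \<delta>)) * (4 * H / \<delta>\<^sup>2)"
      by simp
    also have "\<dots> = (4 - \<delta>\<^sup>2) * H / \<delta>\<^sup>2"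
      unfolding c using \<delta> by (simp add: field_simps power2_eq_square)
    also have "ennreal \<dots> \<le> ennreal (4 * H / \<delta>\<^sup>2)"
      using \<open>0 \<le> H\<close> by (intro ennreal_leI divide_right_mono mult_right_mono) auto
    finally show ?thesis .
  qed
  have next_error: "mean_square M (v (Suc t)) \<le> ennreal ?V" if "mean_square M (v t) \<le> ennreal ?V" for t
  proof -
    have "mean_square M (v (Suc t)) = mean_square M (\<lambda>w. P t w - Q t w)"
      by (rule mean_square_cong) (rule feedback)
    also have "\<dots> \<le> ennreal ((1 - \<delta>) * (4 * H / \<delta>\<^sup>2))"
      using compr \<delta> P[OF that] by (intro mean_square_compression_error_le) auto
    finally show ?thesis
      by (simp add: mult_ac)
  qed
  have v: "mean_square M (v t) \<le> ennreal ?V" for t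
  proof (induction t)
    case 0
    have "mean_square M (v 0) = mean_square M (\<lambda>_. 0 :: real^'d)"
      by (rule mean_square_cong) (rule init)
    then show ?case
      by (simp add: mean_square_def)
  qed (rule next_error)
  show "mean_square M (P t) \<le> ennreal (4 * H / \<delta>\<^sup>2)"
    by (rule P[OF v])
  show "mean_square M (v (Suc t)) \<le> ennreal ?V"
    by (rule v)
qed

section \<open>Second moments of stochastic gradients\<close>

text \<open>
  Orthogonality of the deviation from the conditional mean to the conditional mean itself. Only \<open>X\<close>
  is known to be integrable at this stage, not its square; the almost sure bound on \<open>m\<close> is what
  makes the products integrable. The vector \<open>m\<close> equals the conditional mean only almost surely, so
  the test function in the defining property of the conditional expectation is the \<open>F\<close>-measurable
  \<open>real_cond_exp\<close> of each component, exchanged for the component of \<open>m\<close> afterwards.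
\<close>

lemma (in prob_space) integral_inner_cond_exp:
  fixes X m :: "'a \<Rightarrow> real^'d"
  assumes sub: "subalgebra M F"
    and X: "integrable M X" and m[measurable]: "m \<in> borel_measurable M"
    and cond: "AE w in M. vec_cond_exp M F X w = m w"
    and bounded: "AE w in M. norm (m w) \<le> B"
  shows "integrable M (\<lambda>w. X w \<bullet> m w)" "(\<integral>w. X w \<bullet> m w \<partial>M) = (\<integral>w. (norm (m w))\<^sup>2 \<partial>M)"
proof -
  interpret F: sigma_finite_subalgebra M F
    by (rule sigma_finite_subalgebraI[OF sub])
  have Xk: "integrable M (\<lambda>w. X w $ k)" for k
    using integrable_inner_left[OF X, of "axis k 1"] by (simp add: inner_axis)
  note [measurable] = borel_measurable_integrable[OF X] borel_measurable_integrable[OF Xk]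
  have mk[measurable]: "(\<lambda>w. m w $ k) \<in> borel_measurable M" for k
    using borel_measurable_inner[OF m borel_measurable_const[of "axis k 1"]] by (simp add: inner_axis)
  let ?E = "\<lambda>k. real_cond_exp M F (\<lambda>w. X w $ k)"
  have E: "AE w in M. ?E k w = m w $ k" for k
    using cond by eventually_elim (auto simp: vec_cond_exp_def vec_eq_iff)
  have Efm: "?E k \<in> borel_measurable F" for k
    by simp
  have [measurable]: "?E k \<in> borel_measurable M" for k
    by simp
  have prod_int: "integrable M (\<lambda>w. ?E k w * X w $ k)" for k
  proof (rule Bochner_Integration.integrable_bound[OF integrable_mult_right[OF Xk[of k], of B]])
    show "AE w in M. norm (?E k w * X w $ k) \<le> norm (B * X w $ k)"
      using E[of k] bounded
    proof eventually_elim
      case (elim w)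
      have "\<bar>m w $ k\<bar> \<le> B"
        using component_le_norm_cart[of "m w" k] elim by linarith
      then show ?case
        using elim by (auto simp: abs_mult intro!: mult_right_mono)
    qed
  qed simp
  have prod_eq: "AE w in M. ?E k w * X w $ k = X w $ k * m w $ k" for k
    using E[of k] by eventually_elim simp
  have int: "integrable M (\<lambda>w. X w $ k * m w $ k)" for k
    using prod_int[of k] prod_eq[of k] by (subst integrable_cong_AE[symmetric]) auto
  have sq_eq: "AE w in M. ?E k w * ?E k w = m w $ k * m w $ k" for k
    using E[of k] by eventually_elim simp
  have sq_int: "integrable M (\<lambda>w. m w $ k * m w $ k)" for k
    using F.real_cond_exp_intg(1)[OF prod_int[of k] Efm] sq_eq[of k]
    by (subst integrable_cong_AE[symmetric]) auto
  have eq: "(\<integral>w. X w $ k * m w $ k \<partial>M) = (\<integral>w. m w $ k * m w $ k \<partial>M)" for k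
  proof -
    have "(\<integral>w. X w $ k * m w $ k \<partial>M) = (\<integral>w. ?E k w * X w $ k \<partial>M)"
      using prod_eq[of k] by (intro integral_cong_AE) auto
    also have "\<dots> = (\<integral>w. ?E k w * ?E k w \<partial>M)"
      by (rule F.real_cond_exp_intg(2)[symmetric]) (auto simp: prod_int)
    also have "\<dots> = (\<integral>w. m w $ k * m w $ k \<partial>M)"
      using sq_eq[of k] by (intro integral_cong_AE) auto
    finally show ?thesis .
  qed
  show "integrable M (\<lambda>w. X w \<bullet> m w)"
    using int by (simp add: inner_vec_def)
  show "(\<integral>w. X w \<bullet> m w \<partial>M) = (\<integral>w. (norm (m w))\<^sup>2 \<partial>M)"
    using int sq_int eq by (simp add: inner_vec_def power2_norm_eq_inner)
qed

lemma (in prob_space) mean_square_le_variance_plus_bias: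
  fixes X m :: "'a \<Rightarrow> real^'d"
  assumes sub: "subalgebra M F"
    and X: "integrable M X" and m[measurable]: "m \<in> borel_measurable M"
    and cond: "AE w in M. vec_cond_exp M F X w = m w"
    and var: "AE w in M. nn_cond_exp M F (\<lambda>w. ennreal ((norm (X w - m w))\<^sup>2)) w \<le> ennreal (\<sigma>\<^sup>2)"
    and mean: "AE w in M. (norm (m w))\<^sup>2 \<le> \<omega>\<^sup>2"
  shows "mean_square M X \<le> ennreal (\<sigma>\<^sup>2 + \<omega>\<^sup>2)"
proof -
  note [measurable] = borel_measurable_integrable[OF X]
  have bounded: "AE w in M. norm (m w) \<le> \<bar>\<omega>\<bar>"
    using mean by eventually_elim (metis abs_le_square_iff abs_norm_cancel)
  note cross = integral_inner_cond_exp[OF sub X m cond bounded]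
  have dev: "(\<integral>\<^sup>+w. ennreal ((norm (X w - m w))\<^sup>2) \<partial>M) \<le> ennreal (\<sigma>\<^sup>2)"
  proof -
    have "(\<integral>\<^sup>+w. ennreal ((norm (X w - m w))\<^sup>2) \<partial>M)
        = (\<integral>\<^sup>+w. nn_cond_exp M F (\<lambda>w. ennreal ((norm (X w - m w))\<^sup>2)) w \<partial>M)"
      by (rule nn_integral_nn_cond_exp[OF sub, symmetric]) measurable
    also have "\<dots> \<le> (\<integral>\<^sup>+w. ennreal (\<sigma>\<^sup>2) \<partial>M)"
      by (rule nn_integral_mono_AE[OF var])
    finally show ?thesis
      by (simp add: emeasure_space_1)
  qed
  have dev_int: "integrable M (\<lambda>w. (norm (X w - m w))\<^sup>2)"
    using dev by (intro integrableI_nonneg) (auto intro: le_less_trans)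
  have dev_le: "(\<integral>w. (norm (X w - m w))\<^sup>2 \<partial>M) \<le> \<sigma>\<^sup>2"
    using dev by (subst (asm) nn_integral_eq_integral[OF dev_int]) auto
  have m_int: "integrable M (\<lambda>w. (norm (m w))\<^sup>2)"
    using mean by (intro integrable_const_bound[where B = "\<omega>\<^sup>2"]) auto
  have m_le: "(\<integral>w. (norm (m w))\<^sup>2 \<partial>M) \<le> \<omega>\<^sup>2"
    using integral_mono_AE[OF m_int integrable_const mean] by (simp add: prob_space)
  \<comment> \<open>The cross term is kept as \<open>X \<bullet> m\<close>, whose integral is that of \<open>\<parallel>m\<parallel>\<^sup>2\<close> by orthogonality.\<close>
  have expand: "(norm (X w))\<^sup>2 = (norm (X w - m w))\<^sup>2 + 2 * (X w \<bullet> m w) - (norm (m w))\<^sup>2" for w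
    by (simp add: power2_norm_eq_inner inner_diff_left inner_diff_right inner_commute)
  have int: "integrable M (\<lambda>w. (norm (X w))\<^sup>2)"
    unfolding expand using dev_int m_int cross(1) by simp
  have "(\<integral>w. (norm (X w))\<^sup>2 \<partial>M) = (\<integral>w. (norm (X w - m w))\<^sup>2 \<partial>M) + (\<integral>w. (norm (m w))\<^sup>2 \<partial>M)"
    unfolding expand using dev_int m_int cross by simp
  also have "\<dots> \<le> \<sigma>\<^sup>2 + \<omega>\<^sup>2"
    using dev_le m_le by (rule add_mono)
  finally show ?thesis
    unfolding mean_square_def by (subst nn_integral_eq_integral[OF int]) (auto intro: ennreal_leI simp del: ennreal_plus)
qed

section \<open>Measurability\<close>

lemma GDERIV_gradient:
  fixes h :: "'a::euclidean_space \<Rightarrow> real"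
  assumes "h differentiable (at y)"
  shows "GDERIV h y :> gradient h y"
proof -
  obtain D where D: "(h has_derivative D) (at y)"
    using assms by (auto simp: differentiable_def)
  interpret bounded_linear D
    using D by (rule has_derivative_bounded_linear)
  define v where "v = (\<Sum>b\<in>Basis. D b *\<^sub>R b)"
  have "D u = u \<bullet> v" for u
  proof -
    have "D u = D (\<Sum>b\<in>Basis. (u \<bullet> b) *\<^sub>R b)"
      by (simp add: euclidean_representation)
    also have "\<dots> = u \<bullet> v"
      by (simp add: sum scaleR v_def inner_sum_right mult.commute)
    finally show ?thesis .
  qed
  then have "D = (\<lambda>u. u \<bullet> v)"
    by (rule ext)
  with D have v: "GDERIV h y :> v"
    by (simp add: gderiv_def)
  have "v' = v" if "GDERIV h y :> v'" for v'
  proof -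
    have "(\<lambda>u. u \<bullet> v') = (\<lambda>u. u \<bullet> v)"
      using that v has_derivative_unique unfolding gderiv_def by blast
    then show ?thesis
      using vector_eq_rdot[of v' v] by (simp add: fun_eq_iff inner_commute)
  qed
  then show ?thesis
    unfolding gradient_def using theI[where P = "\<lambda>v. GDERIV h y :> v", OF v] by blast
qed

text \<open>
  Each coordinate is a pointwise limit of difference quotients of a continuous function. For the
  expected loss this makes the deviation of a stochastic gradient from the true gradient a random
  variable, which is needed to integrate its conditional second moment.
\<close>

lemma gradient_borel_measurable:
  fixes h :: "'a::euclidean_space \<Rightarrow> real"
  assumes diff: "\<And>y. h differentiable (at y)"
  shows "gradient h \<in> borel_measurable borel"
proof (subst borel_measurable_euclidean_space, intro ballI)
  fix b :: 'a
  assume "b \<in> Basis"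
  have "continuous_on UNIV h"
    using diff by (simp add: continuous_on_eq_continuous_at differentiable_imp_continuous_within)
  then have [measurable]: "h \<in> borel_measurable borel"
    by (rule borel_measurable_continuous_onI)
  have "(\<lambda>n. (h (y + (1 / real (Suc n)) *\<^sub>R b) - h y) / (1 / real (Suc n))) \<longlonglongrightarrow> gradient h y \<bullet> b" for y
  proof -
    have h: "(h has_derivative (\<lambda>u. u \<bullet> gradient h y)) (at (y + 0 *\<^sub>R b))"
      using GDERIV_gradient[OF diff] by (simp add: gderiv_def)
    have "((\<lambda>s::real. h (y + s *\<^sub>R b)) has_derivative (\<lambda>s. (s *\<^sub>R b) \<bullet> gradient h y)) (at 0)"
      by (rule has_derivative_compose[where f = "\<lambda>s. y + s *\<^sub>R b", OF _ h]) (auto intro!: derivative_eq_intros)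
    then have "((\<lambda>s::real. h (y + s *\<^sub>R b)) has_field_derivative (gradient h y \<bullet> b)) (at 0)"
      by (simp add: has_field_derivative_def inner_commute mult.commute fun_eq_iff)
         (simp add: mult_commute_abs)
    then have "((\<lambda>s. (h (y + s *\<^sub>R b) - h y) / s) \<longlongrightarrow> gradient h y \<bullet> b) (at 0)"
      by (auto dest: DERIV_D)
    moreover have "filterlim (\<lambda>n. 1 / real (Suc n)) (at 0) sequentially"
      using LIMSEQ_inverse_real_of_nat by (auto simp: filterlim_at inverse_eq_divide)
    ultimately show ?thesis
      by (rule filterlim_compose)
  qed
  then show "(\<lambda>y. gradient h y \<bullet> b) \<in> borel_measurable borel"
    by (rule borel_measurable_LIMSEQ_real) measurable
qed

lemma borel_measurable_cong_on_space:
  assumes "h' \<in> borel_measurable \<Omega>" "\<And>w. w \<in> space \<Omega> \<Longrightarrow> h w = h' w"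
  shows "h \<in> borel_measurable \<Omega>"
  using assms measurable_cong[of \<Omega> h h' borel] by blast

lemma dist_EF_SGD_stepD:
  assumes "dist_EF_SGD \<Omega> L C \<eta> M x0 \<xi> r rs x g p \<Delta> e ps \<Delta>s es" "w \<in> space \<Omega>"
  shows "x 0 w = x0" "es 0 w = 0"
    and "i \<in> {1..M} \<Longrightarrow> e 0 i w = 0"
    and "i \<in> {1..M} \<Longrightarrow> g t i w = gradient (\<lambda>y. L y (\<xi> t i w)) (x t w)"
    and "i \<in> {1..M} \<Longrightarrow> p t i w = g t i w + (prev_rate \<eta> t / \<eta> t) *\<^sub>R e t i w"
    and "i \<in> {1..M} \<Longrightarrow> \<Delta> t i w = C (p t i w) (r t i w)"
    and "i \<in> {1..M} \<Longrightarrow> e (Suc t) i w = p t i w - \<Delta> t i w"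
    and "ps t w = (1 / real M) *\<^sub>R (\<Sum>i=1..M. \<Delta> t i w) + (prev_rate \<eta> t / \<eta> t) *\<^sub>R es t w"
    and "\<Delta>s t w = C (ps t w) (rs t w)"
    and "es (Suc t) w = ps t w - \<Delta>s t w"
    and "x (Suc t) w = x t w - \<eta> t *\<^sub>R \<Delta>s t w"
  using assms by (auto simp: dist_EF_SGD_def)

text \<open>
  By induction on the iteration the state \<open>x\<close>, \<open>es\<close>, \<open>e\<close> is measurable, since one iteration is a
  measurable function of the state, the data and the seeds. The recursion is known on the outcomes in
  the space only, and for the workers \<open>1, \<dots>, M\<close> only, which is why every step goes through
  \<open>borel_measurable_cong_on_space\<close>.
\<close>

lemma dist_EF_SGD_measurable:
  fixes x :: "nat \<Rightarrow> 'w \<Rightarrow> real^'d"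
  assumes run: "dist_EF_SGD \<Omega> L C \<eta> M x0 \<xi> r rs x g p \<Delta> e ps \<Delta>s es"
    and [measurable]: "(\<lambda>(y, z). gradient (\<lambda>u. L u z) y) \<in> borel_measurable (borel \<Otimes>\<^sub>M D)"
    and [measurable]: "(\<lambda>(y, s). C y s) \<in> borel_measurable (borel \<Otimes>\<^sub>M S)"
    and \<xi>[measurable]: "\<And>t i. i \<in> {1..M} \<Longrightarrow> \<xi> t i \<in> measurable \<Omega> D"
    and r[measurable]: "\<And>t i. i \<in> {1..M} \<Longrightarrow> r t i \<in> measurable \<Omega> S"
    and rs[measurable]: "\<And>t. rs t \<in> measurable \<Omega> S"
  shows "x t \<in> borel_measurable \<Omega>" "es t \<in> borel_measurable \<Omega>"
    "ps t \<in> borel_measurable \<Omega>" "\<Delta>s t \<in> borel_measurable \<Omega>"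
    "i \<in> {1..M} \<Longrightarrow> e t i \<in> borel_measurable \<Omega>" "i \<in> {1..M} \<Longrightarrow> g t i \<in> borel_measurable \<Omega>"
    "i \<in> {1..M} \<Longrightarrow> p t i \<in> borel_measurable \<Omega>" "i \<in> {1..M} \<Longrightarrow> \<Delta> t i \<in> borel_measurable \<Omega>"
proof -
  note step = dist_EF_SGD_stepD[OF run]
  note via = borel_measurable_cong_on_space
  have iteration:
    "(\<forall>i\<in>{1..M}. g t i \<in> borel_measurable \<Omega> \<and> p t i \<in> borel_measurable \<Omega> \<and> \<Delta> t i \<in> borel_measurable \<Omega>) \<and>
     ps t \<in> borel_measurable \<Omega> \<and> \<Delta>s t \<in> borel_measurable \<Omega>"
    if [measurable]: "x t \<in> borel_measurable \<Omega>" "es t \<in> borel_measurable \<Omega>"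
      and e: "\<forall>i\<in>{1..M}. e t i \<in> borel_measurable \<Omega>" for t
  proof -
    have worker: "g t i \<in> borel_measurable \<Omega> \<and> p t i \<in> borel_measurable \<Omega> \<and> \<Delta> t i \<in> borel_measurable \<Omega>"
      if i: "i \<in> {1..M}" for i
    proof -
      note [measurable] = \<xi>[OF i] r[OF i] e[rule_format, OF i]
      have "(\<lambda>w. (\<lambda>(y, z). gradient (\<lambda>u. L u z) y) (x t w, \<xi> t i w)) \<in> borel_measurable \<Omega>"
        by measurable
      then have [measurable]: "g t i \<in> borel_measurable \<Omega>"
        by (rule via) (simp add: step(4)[OF _ i])
      have "(\<lambda>w. g t i w + (prev_rate \<eta> t / \<eta> t) *\<^sub>R e t i w) \<in> borel_measurable \<Omega>"
        by measurable
      then have [measurable]: "p t i \<in> borel_measurable \<Omega>"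
        by (rule via) (simp add: step(5)[OF _ i])
      have "(\<lambda>w. (\<lambda>(y, s). C y s) (p t i w, r t i w)) \<in> borel_measurable \<Omega>"
        by measurable
      then have "\<Delta> t i \<in> borel_measurable \<Omega>"
        by (rule via) (simp add: step(6)[OF _ i])
      then show ?thesis
        by simp
    qed
    have [measurable]: "(\<lambda>w. \<Sum>i=1..M. \<Delta> t i w) \<in> borel_measurable \<Omega>"
      using worker by (intro borel_measurable_sum) blast
    have "(\<lambda>w. (1 / real M) *\<^sub>R (\<Sum>i=1..M. \<Delta> t i w) + (prev_rate \<eta> t / \<eta> t) *\<^sub>R es t w) \<in> borel_measurable \<Omega>"
      by measurable
    then have [measurable]: "ps t \<in> borel_measurable \<Omega>"
      by (rule via) (rule step(8))
    have "(\<lambda>w. (\<lambda>(y, s). C y s) (ps t w, rs t w)) \<in> borel_measurable \<Omega>"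
      by measurable
    then have "\<Delta>s t \<in> borel_measurable \<Omega>"
      by (rule via) (simp add: step(9))
    then show ?thesis
      using worker by simp
  qed
  have state: "x t \<in> borel_measurable \<Omega> \<and> es t \<in> borel_measurable \<Omega> \<and> (\<forall>i\<in>{1..M}. e t i \<in> borel_measurable \<Omega>)" for t
  proof (induction t)
    case 0
    show ?case
      using step(1-3) by (auto intro: via[OF borel_measurable_const])
  next
    case (Suc t)
    then have [measurable]: "x t \<in> borel_measurable \<Omega>" "ps t \<in> borel_measurable \<Omega>" "\<Delta>s t \<in> borel_measurable \<Omega>"
      using iteration by auto
    have "(\<lambda>w. x t w - \<eta> t *\<^sub>R \<Delta>s t w) \<in> borel_measurable \<Omega>" "(\<lambda>w. ps t w - \<Delta>s t w) \<in> borel_measurable \<Omega>"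
      by measurable
    then have "x (Suc t) \<in> borel_measurable \<Omega>" "es (Suc t) \<in> borel_measurable \<Omega>"
      by - (erule via, erule step(11), erule via, erule step(10))
    moreover have "e (Suc t) i \<in> borel_measurable \<Omega>" if i: "i \<in> {1..M}" for i
    proof -
      have "(\<lambda>w. p t i w - \<Delta> t i w) \<in> borel_measurable \<Omega>"
        using iteration[of t] Suc i by (intro borel_measurable_diff) auto
      then show ?thesis
        by (rule via) (simp add: step(7)[OF _ i])
    qed
    ultimately show ?case
      by blast
  qed
  show "x t \<in> borel_measurable \<Omega>" "es t \<in> borel_measurable \<Omega>"
    "ps t \<in> borel_measurable \<Omega>" "\<Delta>s t \<in> borel_measurable \<Omega>"
    "i \<in> {1..M} \<Longrightarrow> e t i \<in> borel_measurable \<Omega>" "i \<in> {1..M} \<Longrightarrow> g t i \<in> borel_measurable \<Omega>"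
    "i \<in> {1..M} \<Longrightarrow> p t i \<in> borel_measurable \<Omega>" "i \<in> {1..M} \<Longrightarrow> \<Delta> t i \<in> borel_measurable \<Omega>"
    using state[of t] iteration[of t] by auto
qed

lemma history_subalgebra:
  assumes "\<And>t i. i \<in> {1..M} \<Longrightarrow> \<xi> t i \<in> measurable \<Omega> D"
    and "\<And>t i. i \<in> {1..M} \<Longrightarrow> r t i \<in> measurable \<Omega> S"
    and "\<And>t. rs t \<in> measurable \<Omega> S"
  shows "subalgebra \<Omega> (history \<Omega> D S M \<xi> r rs t)"
proof -
  have preimages: "sets (vimage_algebra (space \<Omega>) Y N) \<subseteq> sets \<Omega>" if "Y \<in> measurable \<Omega> N" for Y and N :: "'x measure"
    using measurable_sets[OF that] measurable_space[OF that]
    by (subst sets_vimage_algebra2) auto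
  let ?A = "\<Union>s\<in>{..<t}. (\<Union>i\<in>{1..M}. sets (vimage_algebra (space \<Omega>) (\<xi> s i) D) \<union>
      sets (vimage_algebra (space \<Omega>) (r s i) S)) \<union> sets (vimage_algebra (space \<Omega>) (rs s) S)"
  have "sets (vimage_algebra (space \<Omega>) (\<xi> s i) D) \<subseteq> sets \<Omega>"
    "sets (vimage_algebra (space \<Omega>) (r s i) S) \<subseteq> sets \<Omega>" if "i \<in> {1..M}" for s i
    using assms that by (blast intro!: preimages)+
  moreover have "sets (vimage_algebra (space \<Omega>) (rs s) S) \<subseteq> sets \<Omega>" for s
    using assms(3) by (rule preimages)
  ultimately have A: "?A \<subseteq> sets \<Omega>"
    by blast
  then have "?A \<subseteq> Pow (space \<Omega>)"
    using sets.sets_into_space by blast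
  then show ?thesis
    using A by (simp add: subalgebra_def history_def sets.sigma_sets_subset)
qed

section \<open>The bound on the residual errors\<close>

lemma prev_rate_ratio_le_1:
  assumes "incseq \<eta>" "\<And>t. \<eta> t > 0"
  shows "\<bar>prev_rate \<eta> t / \<eta> t\<bar> \<le> 1"
proof (cases t)
  case (Suc s)
  then show ?thesis
    using incseq_SucD[OF assms(1), of s] assms(2)[of s] assms(2)[of t] by (simp add: prev_rate_def)
qed (simp add: prev_rate_def)

theorem corollary1:
  fixes \<Omega> :: "'w measure" and D :: "'z measure" and S :: "'s measure"
    and L :: "real^'d \<Rightarrow> 'z \<Rightarrow> real" and f :: "real^'d \<Rightarrow> real"
    and C :: "real^'d \<Rightarrow> 's \<Rightarrow> real^'d"
    and \<eta> :: "nat \<Rightarrow> real" and M :: nat and \<delta> \<sigma> \<omega> G :: real and x0 :: "real^'d"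
    and \<xi> :: "nat \<Rightarrow> nat \<Rightarrow> 'w \<Rightarrow> 'z" and r :: "nat \<Rightarrow> nat \<Rightarrow> 'w \<Rightarrow> 's" and rs :: "nat \<Rightarrow> 'w \<Rightarrow> 's"
    and x ps \<Delta>s es :: "nat \<Rightarrow> 'w \<Rightarrow> real^'d"
    and g p \<Delta> e :: "nat \<Rightarrow> nat \<Rightarrow> 'w \<Rightarrow> real^'d"
  assumes "prob_space \<Omega>" and "prob_space D"
    and workers: "M \<ge> 1"
    and compressor: "delta_compressor S C \<delta>"
    and loss_integrable: "\<And>y. integrable D (L y)"
    and f_def: "f = expected_loss D L"
    and f_diff: "\<And>y. f differentiable (at y)"
    and grad_meas: "(\<lambda>(y, z). gradient (\<lambda>u. L u z) y) \<in> borel_measurable (borel \<Otimes>\<^sub>M D)"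
    and data: "\<And>t i. i \<in> {1..M} \<Longrightarrow> \<xi> t i \<in> measurable \<Omega> D"
    and worker_seeds: "\<And>t i. i \<in> {1..M} \<Longrightarrow> r t i \<in> measurable \<Omega> S \<and> distr \<Omega> S (r t i) = S"
    and server_seeds: "\<And>t. rs t \<in> measurable \<Omega> S \<and> distr \<Omega> S (rs t) = S"
    and run: "dist_EF_SGD \<Omega> L C \<eta> M x0 \<xi> r rs x g p \<Delta> e ps \<Delta>s es"
    and loss_diff: "\<And>t i. i \<in> {1..M} \<Longrightarrow>
      AE w in \<Omega>. (\<lambda>y. L y (\<xi> t i w)) differentiable (at (x t w))"
    and worker_compression: "\<And>t i. i \<in> {1..M} \<Longrightarrow> compresses_given_input \<Omega> \<delta> (p t i) (\<Delta> t i)"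
    and server_compression: "\<And>t. compresses_given_input \<Omega> \<delta> (ps t) (\<Delta>s t)"
    and stoch_grad: "unbiased_bounded_variance \<Omega> (history \<Omega> D S M \<xi> r rs) M f x g \<sigma>"
    and grad_bound: "bounded_gradient \<Omega> f x \<omega>"
    and G_def: "G\<^sup>2 = \<sigma>\<^sup>2 + \<omega>\<^sup>2"
    and rates_mono: "incseq \<eta>"
    and rates_pos: "\<And>t. \<eta> t > 0"
  shows "\<And>t. integrable \<Omega> (\<lambda>w. (norm (es (Suc t) w + (1 / real M) *\<^sub>R (\<Sum>i=1..M. e (Suc t) i w)))\<^sup>2) \<and>
    (\<integral>w. (norm (es (Suc t) w + (1 / real M) *\<^sub>R (\<Sum>i=1..M. e (Suc t) i w)))\<^sup>2 \<partial>\<Omega>)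
      \<le> 8 * (1 - \<delta>) * G\<^sup>2 / \<delta>\<^sup>2 * (1 + 16 / \<delta>\<^sup>2)"
proof -
  fix t
  interpret prob_space \<Omega>
    by fact
  have \<delta>: "0 < \<delta>" "\<delta> < 1" and C: "(\<lambda>(y, s). C y s) \<in> borel_measurable (borel \<Otimes>\<^sub>M S)"
    using compressor by (auto simp: delta_compressor_def)
  note step = dist_EF_SGD_stepD[OF run]
  have seeds: "\<And>t i. i \<in> {1..M} \<Longrightarrow> r t i \<in> measurable \<Omega> S" "\<And>t. rs t \<in> measurable \<Omega> S"
    using worker_seeds server_seeds by auto
  have meas: "x t \<in> borel_measurable \<Omega>" "es t \<in> borel_measurable \<Omega>"
    "ps t \<in> borel_measurable \<Omega>" "\<Delta>s t \<in> borel_measurable \<Omega>"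
    "i \<in> {1..M} \<Longrightarrow> e t i \<in> borel_measurable \<Omega>" "i \<in> {1..M} \<Longrightarrow> g t i \<in> borel_measurable \<Omega>"
    "i \<in> {1..M} \<Longrightarrow> p t i \<in> borel_measurable \<Omega>" "i \<in> {1..M} \<Longrightarrow> \<Delta> t i \<in> borel_measurable \<Omega>" for t i
    using dist_EF_SGD_measurable[OF run grad_meas C data seeds] by blast+
  note ratio = prev_rate_ratio_le_1[OF rates_mono rates_pos]

  have g_bound: "mean_square \<Omega> (g t i) \<le> ennreal (G\<^sup>2)" if i: "i \<in> {1..M}" for t i
    unfolding G_def
  proof (rule mean_square_le_variance_plus_bias)
    show "subalgebra \<Omega> (history \<Omega> D S M \<xi> r rs t)"
      by (rule history_subalgebra[OF data seeds])
    show "(\<lambda>w. gradient f (x t w)) \<in> borel_measurable \<Omega>"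
      using measurable_compose[OF meas(1) gradient_borel_measurable[OF f_diff]] .
  qed (use stoch_grad grad_bound i in \<open>auto simp: unbiased_bounded_variance_def bounded_gradient_def\<close>)

  have worker: "mean_square \<Omega> (p t i) \<le> ennreal (4 * G\<^sup>2 / \<delta>\<^sup>2)"
    "mean_square \<Omega> (e (Suc t) i) \<le> ennreal (4 * (1 - \<delta>) * G\<^sup>2 / \<delta>\<^sup>2)" if i: "i \<in> {1..M}" for t i
  proof -
    note bounds = error_feedback_bounds[where h = "\<lambda>t. g t i" and v = "\<lambda>t. e t i" and P = "\<lambda>t. p t i"
          and Q = "\<lambda>t. \<Delta> t i", OF \<delta> zero_le_power2 meas(6)[OF i] meas(5)[OF i] meas(7)[OF i] meas(8)[OF i]
          g_bound[OF i] ratio step(3)[OF _ i] step(5)[OF _ i] step(7)[OF _ i] worker_compression[OF i]]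
    show "mean_square \<Omega> (p t i) \<le> ennreal (4 * G\<^sup>2 / \<delta>\<^sup>2)"
      using bounds(1) .
    show "mean_square \<Omega> (e (Suc t) i) \<le> ennreal (4 * (1 - \<delta>) * G\<^sup>2 / \<delta>\<^sup>2)"
      using bounds(2) by simp
  qed

  \<comment> \<open>A transmitted vector is an input minus the following residual; Young with weight \<open>1\<close>.\<close>
  let ?B = "16 * G\<^sup>2 / \<delta>\<^sup>2"
  have \<Delta>_bound: "mean_square \<Omega> (\<Delta> t i) \<le> ennreal ?B" if i: "i \<in> {1..M}" for t i
  proof -
    have "mean_square \<Omega> (\<Delta> t i) = mean_square \<Omega> (\<lambda>w. p t i w + (- 1) *\<^sub>R e (Suc t) i w)"
      by (rule mean_square_cong) (simp add: step(7)[OF _ i])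
    also have "\<dots> \<le> ennreal ((1 + 1 / 1) * (4 * G\<^sup>2 / \<delta>\<^sup>2) + (1 + 1) * (4 * (1 - \<delta>) * G\<^sup>2 / \<delta>\<^sup>2))"
    proof (rule mean_square_add_le)
      show "mean_square \<Omega> (\<lambda>w. (- 1) *\<^sub>R e (Suc t) i w) \<le> ennreal (4 * (1 - \<delta>) * G\<^sup>2 / \<delta>\<^sup>2)"
        using worker(2)[OF i, of t] mean_square_scaleR_le[of "-1" \<Omega> "e (Suc t) i"]
        by (auto intro: order_trans)
    qed (use i worker(1)[OF i] meas \<delta> in auto)
    also have "\<dots> \<le> ennreal ?B"
    proof (rule ennreal_leI)
      have "(1 + 1 / 1) * (4 * G\<^sup>2 / \<delta>\<^sup>2) + (1 + 1) * (4 * (1 - \<delta>) * G\<^sup>2 / \<delta>\<^sup>2)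
          = (16 - 8 * \<delta>) * G\<^sup>2 / \<delta>\<^sup>2"
        by (simp add: add_divide_distrib[symmetric] algebra_simps)
      also have "\<dots> \<le> ?B"
        using \<delta> by (intro divide_right_mono mult_right_mono) auto
      finally show "(1 + 1 / 1) * (4 * G\<^sup>2 / \<delta>\<^sup>2) + (1 + 1) * (4 * (1 - \<delta>) * G\<^sup>2 / \<delta>\<^sup>2) \<le> ?B" .
    qed
    finally show ?thesis .
  qed

  have M: "{1..M} \<noteq> {}"
    using workers by simp
  have average_meas: "(\<lambda>w. (1 / real M) *\<^sub>R (\<Sum>i=1..M. Y i w)) \<in> borel_measurable \<Omega>"
    if "\<And>i. i \<in> {1..M} \<Longrightarrow> Y i \<in> borel_measurable \<Omega>" for Y :: "nat \<Rightarrow> 'w \<Rightarrow> real^'d"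
    using that by (intro borel_measurable_scaleR borel_measurable_sum) auto
  have average_bound: "mean_square \<Omega> (\<lambda>w. (1 / real M) *\<^sub>R (\<Sum>i=1..M. Y i w)) \<le> ennreal B"
    if "\<And>i. i \<in> {1..M} \<Longrightarrow> Y i \<in> borel_measurable \<Omega>" "0 \<le> B"
      "\<And>i. i \<in> {1..M} \<Longrightarrow> mean_square \<Omega> (Y i) \<le> ennreal B" for Y :: "nat \<Rightarrow> 'w \<Rightarrow> real^'d" and B
    using mean_square_average_le[OF _ M, of Y \<Omega> B] that by simp

  have "0 \<le> ?B"
    by simp
  have "mean_square \<Omega> (es (Suc t)) \<le> ennreal (4 * (1 - \<delta>) * ?B / \<delta>\<^sup>2)"
    by (rule error_feedback_bounds(2)[OF \<delta> \<open>0 \<le> ?B\<close> average_meas[OF meas(8)] meas(2,3,4)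
          average_bound[OF meas(8) \<open>0 \<le> ?B\<close> \<Delta>_bound] ratio step(2) step(8) step(10) server_compression])
  moreover have "mean_square \<Omega> (\<lambda>w. (1 / real M) *\<^sub>R (\<Sum>i=1..M. e (Suc t) i w))
      \<le> ennreal (4 * (1 - \<delta>) * G\<^sup>2 / \<delta>\<^sup>2)"
    using worker(2) \<delta> by (intro average_bound meas(5)) auto
  ultimately have "mean_square \<Omega> (\<lambda>w. es (Suc t) w + (1 / real M) *\<^sub>R (\<Sum>i=1..M. e (Suc t) i w))
      \<le> ennreal ((1 + 1 / 1) * (4 * (1 - \<delta>) * ?B / \<delta>\<^sup>2) + (1 + 1) * (4 * (1 - \<delta>) * G\<^sup>2 / \<delta>\<^sup>2))"
    using \<delta> by (intro mean_square_add_le meas(2) average_meas meas(5)) auto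
  also have "(1 + 1 / 1) * (4 * (1 - \<delta>) * ?B / \<delta>\<^sup>2) + (1 + 1) * (4 * (1 - \<delta>) * G\<^sup>2 / \<delta>\<^sup>2)
      = 8 * (1 - \<delta>) * G\<^sup>2 / \<delta>\<^sup>2 * (1 + 16 / \<delta>\<^sup>2)"
    using \<delta> by (simp add: field_simps)
  finally have total: "(\<integral>\<^sup>+w. ennreal ((norm (es (Suc t) w + (1 / real M) *\<^sub>R (\<Sum>i=1..M. e (Suc t) i w)))\<^sup>2) \<partial>\<Omega>)
      \<le> ennreal (8 * (1 - \<delta>) * G\<^sup>2 / \<delta>\<^sup>2 * (1 + 16 / \<delta>\<^sup>2))"
    unfolding mean_square_def .
  have "(\<lambda>w. es (Suc t) w + (1 / real M) *\<^sub>R (\<Sum>i=1..M. e (Suc t) i w)) \<in> borel_measurable \<Omega>"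
    by (intro borel_measurable_add meas(2) average_meas meas(5))
  then have int: "integrable \<Omega> (\<lambda>w. (norm (es (Suc t) w + (1 / real M) *\<^sub>R (\<Sum>i=1..M. e (Suc t) i w)))\<^sup>2)"
    using total by (intro integrableI_nonneg) (auto intro: le_less_trans)
  show "integrable \<Omega> (\<lambda>w. (norm (es (Suc t) w + (1 / real M) *\<^sub>R (\<Sum>i=1..M. e (Suc t) i w)))\<^sup>2) \<and>
    (\<integral>w. (norm (es (Suc t) w + (1 / real M) *\<^sub>R (\<Sum>i=1..M. e (Suc t) i w)))\<^sup>2 \<partial>\<Omega>)
      \<le> 8 * (1 - \<delta>) * G\<^sup>2 / \<delta>\<^sup>2 * (1 + 16 / \<delta>\<^sup>2)"
    using int total \<delta> by (subst (asm) nn_integral_eq_integral[OF int]) auto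
qed

end
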